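(* Let $a\ge 0$ and $b>0$ be real numbers, let $w=a+ib$, and let $p(z)=(z^2-1)(z-w)$ be the monic cubic complex polynomial with distinct roots $\theta_1=-1$, $\theta_2=1$, $\theta_3=w$. Its critical points are $c_1=\frac{1}{3}\left(w+\sqrt{w^2+3}\right)$ and $c_2=\frac{1}{3}\left(w-\sqrt{w^2+3}\right)$, and they satisfy the following. (i) If $a>0$, then $c_2\in V(-1)$. (ii) If $a=0$ and $b<\sqrt{3}$, then $c_2\in V(-1)$ and $c_1\in V(1)$.
   Context: For a root $\theta$ of $p$, its Voronoi cell is $V(\theta)=\{z\in\mathbb{C}: |z-\theta|<|z-\theta'| \text{ for every root } \theta'\neq\theta \text{ of } p\}$. The square root $\sqrt{w^2+3}$ is taken as follows: writing $w^2+3=s+id$ with $s=a^2-b^2+3$ and $d=2ab\ge 0$, one sets $\sqrt{s+id}=A+iB$ with $A=\frac{1}{\sqrt{2}}\sqrt{\sqrt{s^2+d^2}+s}\ge 0$ and $B=\frac{1}{\sqrt{2}}\sqrt{\sqrt{s^2+d^2}-s}\ge 0$. *)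

theory Defs
  imports Complex_Main "HOL-Computational_Algebra.Polynomial"
begin

definition voronoi_cell :: "complex poly \<Rightarrow> complex \<Rightarrow> complex set" where
  "voronoi_cell p \<theta> =
     {z. \<forall>\<theta>'. poly p \<theta>' = 0 \<and> \<theta>' \<noteq> \<theta> \<longrightarrow> cmod (z - \<theta>) < cmod (z - \<theta>')}"

definition critical_points :: "complex poly \<Rightarrow> complex set" where
  "critical_points p = {z. poly (pderiv p) z = 0}"

(* Square root in the closed first quadrant. It is a square root of z only for Im z \<ge> 0. *)
definition quadrant_sqrt :: "complex \<Rightarrow> complex" where
  "quadrant_sqrt z =
     (let s = Re z; d = Im z
      in Complex (1 / sqrt 2 * sqrt (sqrt (s\<^sup>2 + d\<^sup>2) + s))
                 (1 / sqrt 2 * sqrt (sqrt (s\<^sup>2 + d\<^sup>2) - s)))"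

lemma quadrant_sqrt_eq_csqrt:
  assumes "Im z \<ge> 0"
  shows "quadrant_sqrt z = csqrt z"
proof (cases "Im z = 0")
  case True
  then show ?thesis
    by (simp add: quadrant_sqrt_def Let_def complex_eq_iff cmod_def real_sqrt_divide)
next
  case False
  with assms have "sgn (Im z) = 1" by simp
  with False show ?thesis
    by (simp add: quadrant_sqrt_def Let_def complex_eq_iff cmod_def real_sqrt_divide)
qed

end

theory Submission
  imports Defs
begin

text \<open>Write \<open>A + i B\<close> for the square root of \<open>w\<^sup>2 + 3\<close>, so that \<open>A\<^sup>2 - B\<^sup>2 = a\<^sup>2 - b\<^sup>2 + 3\<close> and
  \<open>A B = a b\<close>. The first inequality defining the cell of \<open>-1\<close> says \<open>A > a\<close>, since \<open>3 Re c\<^sub>2 = a - A\<close>.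
  With \<open>x = A - a\<close>, the second one reduces to \<open>3 a\<^sup>2 + x (2 - x) + B\<^sup>2 + 2 b B > 0\<close>, which holds
  because \<open>x\<^sup>2 \<le> A\<^sup>2 - a\<^sup>2 \<le> 3\<close>. For \<open>a = 0\<close> the point \<open>c\<^sub>1\<close> is the mirror image of \<open>c\<^sub>2\<close> in the
  imaginary axis.\<close>

text \<open>The two claimed points have sum \<open>2 * w / 3\<close> and product
  \<open>(w\<^sup>2 - q\<^sup>2) / 9 = - 1 / 3\<close>, as the roots of the derivative must. The
  sign of \<open>q\<close> does not matter.\<close>

lemma critical_points_cubic:
  fixes w q :: complex
  assumes "q\<^sup>2 = w\<^sup>2 + 3"
  shows "critical_points (([:0, 1:]\<^sup>2 - 1) * ([:0, 1:] - [:w:])) =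
           {1 / 3 * (w + q), 1 / 3 * (w - q)}"
proof -
  have "poly (pderiv (([:0, 1:]\<^sup>2 - 1) * ([:0, 1:] - [:w:]))) z = 3 * z\<^sup>2 - 2 * w * z - 1" for z
    by (simp add: pderiv_mult pderiv_diff pderiv_pCons power2_eq_square algebra_simps)
  also have "3 * z\<^sup>2 - 2 * w * z - 1 = 3 * ((z - 1 / 3 * (w + q)) * (z - 1 / 3 * (w - q)))" for z
    using assms by (simp add: power2_eq_square algebra_simps) (simp add: field_simps)
  finally show ?thesis
    by (auto simp: critical_points_def)
qed

text \<open>The fixed product plays \<open>A\<close> against \<open>B\<close>: \<open>A <= a\<close>
  would force \<open>b <= B\<close>, contradicting the surplus 3 in \<open>diff\<close>. Conversely
  \<open>a < A\<close> forces \<open>B <= b\<close>, hence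
  \<open>A\<^sup>2 <= a\<^sup>2 + 3\<close>.\<close>

lemma sqrt_bounds:
  fixes a b A B :: real
  assumes diff: "A\<^sup>2 - B\<^sup>2 = a\<^sup>2 - b\<^sup>2 + 3" and prod: "A * B = a * b"
    and "A \<ge> 0" "a \<ge> 0" "b > 0" and cases: "a > 0 \<or> b\<^sup>2 < 3"
  shows "a < A" "A < a + 2" "0 \<le> B"
proof -
  \<comment> \<open>If \<open>A = 0\<close> then \<open>a = 0\<close>, so \<open>cases\<close>
    leaves \<open>b\<^sup>2 < 3\<close> and \<open>diff\<close> makes \<open>- B\<^sup>2\<close>
    positive.\<close>
  have "A \<noteq> 0"
  proof
    assume "A = 0"
    then have "a = 0" using prod \<open>b > 0\<close> by simp
    with \<open>A = 0\<close> diff cases show False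
      using zero_le_power2[of B] by simp
  qed
  with \<open>A \<ge> 0\<close> have A: "A > 0" by simp
  show B: "0 \<le> B"
    using prod A \<open>a \<ge> 0\<close> \<open>b > 0\<close> by (smt (verit) mult_pos_neg mult_nonneg_nonneg)
  show "a < A"
  proof (rule ccontr)
    assume "\<not> a < A"
    then have "A \<le> a" by simp
    then have "A * b \<le> A * B"
      using prod \<open>b > 0\<close> by simp
    then have "b\<^sup>2 \<le> B\<^sup>2"
      using A \<open>b > 0\<close> by (simp add: power_mono)
    moreover have "A\<^sup>2 \<le> a\<^sup>2"
      using \<open>A \<le> a\<close> A by (simp add: power_mono)
    ultimately show False using diff by simp
  qed
  then have "A * B \<le> A * b"
    using prod \<open>b > 0\<close> by simp
  then have "B\<^sup>2 \<le> b\<^sup>2"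
    using A B by (simp add: power_mono)
  then have "A\<^sup>2 \<le> a\<^sup>2 + 3"
    using diff by simp
  also have "\<dots> < (a + 2)\<^sup>2"
    using \<open>a \<ge> 0\<close> by (simp add: power2_sum)
  finally show "A < a + 2"
    using \<open>a \<ge> 0\<close> by (simp add: power2_less_imp_less)
qed

text \<open>Scaling by 3 and squaring turns distance comparisons at a critical point into polynomial
  inequalities in \<open>a\<close>, \<open>b\<close>, \<open>A\<close>, \<open>B\<close>.\<close>

lemma cmod_scaled_less_iff:
  "cmod (1 / 3 * u - v) < cmod (1 / 3 * u - v') \<longleftrightarrow>
     (Re u - 3 * Re v)\<^sup>2 + (Im u - 3 * Im v)\<^sup>2 < (Re u - 3 * Re v')\<^sup>2 + (Im u - 3 * Im v')\<^sup>2"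
proof -
  have "cmod (1 / 3 * u - v) = cmod (u - 3 * v) / 3" for v
  proof -
    have "1 / 3 * u - v = (u - 3 * v) / 3" by (simp add: field_simps)
    then show ?thesis by (simp only: norm_divide norm_numeral)
  qed
  then have "cmod (1 / 3 * u - v) < cmod (1 / 3 * u - v') \<longleftrightarrow> cmod (u - 3 * v) < cmod (u - 3 * v')"
    by (simp only: divide_less_cancel) simp
  then show ?thesis by (simp add: cmod_def)
qed

lemma mem_voronoi_cell_cubic:
  fixes w z :: complex
  shows "cmod (z - (-1)) < cmod (z - 1) \<Longrightarrow> cmod (z - (-1)) < cmod (z - w) \<Longrightarrow>
           z \<in> voronoi_cell (([:0, 1:]\<^sup>2 - 1) * ([:0, 1:] - [:w:])) (-1)"
    and "cmod (z - 1) < cmod (z - (-1)) \<Longrightarrow> cmod (z - 1) < cmod (z - w) \<Longrightarrow>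
           z \<in> voronoi_cell (([:0, 1:]\<^sup>2 - 1) * ([:0, 1:] - [:w:])) 1"
  by (auto simp: voronoi_cell_def power2_eq_1_iff)

theorem theorem2:
  fixes a b :: real and w c1 c2 :: complex and p :: "complex poly"
  assumes "a \<ge> 0" and "b > 0"
    and "w = of_real a + \<i> * of_real b"
    and "p = ([:0, 1:]\<^sup>2 - 1) * ([:0, 1:] - [:w:])"
    and "c1 = 1 / 3 * (w + quadrant_sqrt (w\<^sup>2 + 3))"
    and "c2 = 1 / 3 * (w - quadrant_sqrt (w\<^sup>2 + 3))"
  shows "critical_points p = {c1, c2} \<and>
         (a > 0 \<longrightarrow> c2 \<in> voronoi_cell p (-1)) \<and>
         (a = 0 \<and> b < sqrt 3 \<longrightarrow> c2 \<in> voronoi_cell p (-1) \<and> c1 \<in> voronoi_cell p 1)"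
proof -
  define q where "q = quadrant_sqrt (w\<^sup>2 + 3)"
  define A B where "A = Re q" and "B = Im q"
  have w: "Re w = a" "Im w = b" using assms(3) by simp_all
  \<comment> \<open>This imaginary part is \<open>2 * a * b\<close>; its sign makes \<open>q\<close>
    a genuine square root.\<close>
  have "Im (w\<^sup>2 + 3) \<ge> 0"
    using \<open>a \<ge> 0\<close> \<open>b > 0\<close> by (simp add: w Im_power2)
  then have q: "q = csqrt (w\<^sup>2 + 3)"
    by (simp add: q_def quadrant_sqrt_eq_csqrt)
  then have qq: "q\<^sup>2 = w\<^sup>2 + 3" by simp
  have A0: "A \<ge> 0"
    using csqrt_principal[of "w\<^sup>2 + 3"] by (auto simp: A_def q)
  have diff: "A\<^sup>2 - B\<^sup>2 = a\<^sup>2 - b\<^sup>2 + 3"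
    using arg_cong[OF qq, of Re] by (simp add: A_def B_def w Re_power2)
  have prod: "A * B = a * b"
    using arg_cong[OF qq, of Im] by (simp add: A_def B_def w Im_power2)
  have c2: "c2 \<in> voronoi_cell p (-1)" if "a > 0 \<or> b\<^sup>2 < 3"
  proof -
    note bounds = sqrt_bounds[OF diff prod A0 \<open>a \<ge> 0\<close> \<open>b > 0\<close> that]
    have "0 < (A - a) * (2 - (A - a))"
      using bounds by simp
    moreover have "0 \<le> b * B"
      using bounds \<open>b > 0\<close> by simp
    ultimately have "0 < 3 * a\<^sup>2 + (A - a) * (2 - (A - a)) + B\<^sup>2 + 2 * (b * B)"
      by (simp add: add_nonneg_pos add_pos_nonneg)
    \<comment> \<open>After eliminating \<open>b\<^sup>2\<close> by \<open>diff\<close>, the right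
      side minus the left is three times the positive expression above.\<close>
    then have "(a - A + 3)\<^sup>2 + (b - B)\<^sup>2 < (a - A - 3 * a)\<^sup>2 + (b - B - 3 * b)\<^sup>2"
      using diff by (simp add: power2_eq_square algebra_simps)
    moreover have "(a - A + 3)\<^sup>2 < (a - A - 3)\<^sup>2"
      using bounds by (simp add: power2_eq_square algebra_simps)
    ultimately show ?thesis
      unfolding assms(4) assms(6) q_def[symmetric]
      by (intro mem_voronoi_cell_cubic) (simp_all only: cmod_scaled_less_iff, simp_all add: w A_def B_def)
  qed
  have c1: "c1 \<in> voronoi_cell p 1" if "a = 0" "b\<^sup>2 < 3"
  proof -
    note bounds = sqrt_bounds[OF diff prod A0 \<open>a \<ge> 0\<close> \<open>b > 0\<close> disjI2[OF \<open>b\<^sup>2 < 3\<close>]]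
    have B: "B = 0" using prod bounds \<open>a = 0\<close> by auto
    have "0 < A * (2 - A)"
      using bounds \<open>a = 0\<close> by simp
    \<comment> \<open>Here \<open>A\<^sup>2 = 3 - b\<^sup>2\<close>, so the sides differ by
      \<open>3 * A * (2 - A)\<close>.\<close>
    then have "(A - 3)\<^sup>2 + b\<^sup>2 < A\<^sup>2 + (b - 3 * b)\<^sup>2"
      using diff \<open>a = 0\<close> B by (simp add: power2_eq_square algebra_simps)
    moreover have "(A - 3)\<^sup>2 < (A + 3)\<^sup>2"
      using bounds \<open>a = 0\<close> by (simp add: power2_eq_square algebra_simps)
    ultimately show ?thesis
      unfolding assms(4) assms(5) q_def[symmetric] using \<open>a = 0\<close> B
      by (intro mem_voronoi_cell_cubic) (simp_all only: cmod_scaled_less_iff, simp_all add: w A_def B_def)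
  qed
  have "b\<^sup>2 < 3" if "b < sqrt 3"
    using power_strict_mono[OF that, of 2] \<open>b > 0\<close> by simp
  then show ?thesis
    using c1 c2 critical_points_cubic[OF qq, folded assms(4), unfolded q_def, folded assms(5,6)]
    by blast
qed

end
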